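(* Let $n<p$, let $\mathbf X\in\mathbb R^{p\times n}$ have full column rank $n$, and let $\mathbf y\in\mathbb R^p$. Let $\mathbf A\in\{0,1\}^{n\times K}$ be a source-membership matrix: each row of $\mathbf A$ has exactly one entry equal to $1$ (the others being $0$), and each column of $\mathbf A$ contains at least one $1$. Put $\mathbf P_{\mathbf A}=\mathbf A(\mathbf A^\top\mathbf A)^{-1}\mathbf A^\top$, $\hat{\mathbf M}=\mathbf X\mathbf A(\mathbf A^\top\mathbf A)^{-1}$, $\mathbf S=\mathbf X(\mathbf I_n-\mathbf P_{\mathbf A})\mathbf X^\top$, and for $\gamma>0$ let $\hat\Sigma_\gamma$ be a positive scalar multiple of $\mathbf S+\gamma\mathbf I_p$. Let $$\hat{\boldsymbol\theta}_\gamma=(\hat{\mathbf M}^\top\hat\Sigma_\gamma^{-1}\hat{\mathbf M})^{-1}\hat{\mathbf M}^\top\hat\Sigma_\gamma^{-1}\mathbf y .$$ Then $$\lim_{\gamma\to0}\hat{\boldsymbol\theta}_\gamma=\hat{\boldsymbol\theta}_{\mathrm{RTS}}\qquad\text{and}\qquad \lim_{\gamma\to\infty}\hat{\boldsymbol\theta}_\gamma=\hat{\boldsymbol\theta}_{\mathrm{ATR}},$$ where $\hat{\boldsymbol\theta}_{\mathrm{RTS}}=\mathbf A^\top(\mathbf X^\top\mathbf X)^{-1}\mathbf X^\top\mathbf y$ and $\hat{\boldsymbol\theta}_{\mathrm{ATR}}=\mathbf A^\top\mathbf A(\mathbf A^\top\mathbf X^\top\mathbf X\mathbf A)^{-1}\mathbf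 A^\top\mathbf X^\top\mathbf y$.
   Context: The columns of $\mathbf X$ are $n$ dictionary profiles, each belonging to exactly one of $K$ source categories; $A_{ik}=1$ if profile $i$ belongs to category $k$ and $A_{ik}=0$ otherwise. The limit $\gamma\to0$ is through positive values of $\gamma$. RTS stands for "regress-then-sum" and ATR for "average-then-regress". *)

theory Defs
  imports "HOL-Analysis.Analysis"
begin

text \<open>A $p \times n$ matrix has type \<open>real ^ 'n ^ 'p\<close>: the row index type is written last.\<close>

definition source_membership :: "real ^ 'k ^ 'n \<Rightarrow> bool" where
  "source_membership A \<longleftrightarrow>
     (\<forall>i k. A $ i $ k \<in> {0, 1}) \<and>
     (\<forall>i. \<exists>!k. A $ i $ k = 1) \<and>
     (\<forall>k. \<exists>i. A $ i $ k = 1)"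

definition membership_proj :: "real ^ 'k ^ 'n \<Rightarrow> real ^ 'n ^ 'n" where
  "membership_proj A = A ** matrix_inv (transpose A ** A) ** transpose A"

definition category_means :: "real ^ 'n ^ 'p \<Rightarrow> real ^ 'k ^ 'n \<Rightarrow> real ^ 'k ^ 'p" where
  "category_means X A = X ** A ** matrix_inv (transpose A ** A)"

definition within_scatter :: "real ^ 'n ^ 'p \<Rightarrow> real ^ 'k ^ 'n \<Rightarrow> real ^ 'p ^ 'p" where
  "within_scatter X A = X ** (mat 1 - membership_proj A) ** transpose X"

definition gls_estimator ::
    "real ^ 'k ^ 'p \<Rightarrow> real ^ 'p ^ 'p \<Rightarrow> real ^ 'p \<Rightarrow> real ^ 'k" where
  "gls_estimator M \<Sigma> y =
     (matrix_inv (transpose M ** matrix_inv \<Sigma> ** M) ** transpose M ** matrix_inv \<Sigma>) *v y"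

text \<open>Regress-then-sum and average-then-regress.\<close>

definition theta_RTS ::
    "real ^ 'n ^ 'p \<Rightarrow> real ^ 'k ^ 'n \<Rightarrow> real ^ 'p \<Rightarrow> real ^ 'k" where
  "theta_RTS X A y =
     (transpose A ** matrix_inv (transpose X ** X) ** transpose X) *v y"

definition theta_ATR ::
    "real ^ 'n ^ 'p \<Rightarrow> real ^ 'k ^ 'n \<Rightarrow> real ^ 'p \<Rightarrow> real ^ 'k" where
  "theta_ATR X A y =
     (transpose A ** A ** matrix_inv (transpose A ** transpose X ** X ** A)
       ** transpose A ** transpose X) *v y"

end

theory Submission
  imports Defs
begin

text \<open>Let \<open>\<theta>\<close> be the estimator for \<open>S + \<gamma> I\<close>, put \<open>u = (S + \<gamma> I)\<^sup>-\<^sup>1 (y - M \<theta>)\<close>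
  and \<open>w = X\<^sup>T u\<close>. The normal equations say \<open>A\<^sup>T w = 0\<close>, so the projection
  disappears from \<open>S u = X w\<close> and \<open>y = X w + \<gamma> u + M \<theta>\<close>. Applying \<open>A\<^sup>T (X\<^sup>T X)\<^sup>-\<^sup>1 X\<^sup>T\<close>
  and \<open>A\<^sup>T X\<^sup>T\<close> to this identity expresses the distance of \<open>\<theta>\<close> from the two limits as a fixed linear
  map applied to \<open>\<gamma> w\<close> and to \<open>w\<close>. Pairing the identity with \<open>X (X\<^sup>T X)\<^sup>-\<^sup>1 w\<close> shows that
  \<open>w\<close> stays bounded, and pairing it with \<open>u\<close> shows that \<open>\<gamma> u\<close>, hence \<open>\<gamma> w\<close>, stays bounded.\<close>

declare transpose_matrix_vector [simp del]

section \<open>Inverses, transposes and Gram matrices\<close>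

lemma invertible_if_kernel_trivial:
  fixes B :: "real ^ 'n ^ 'n"
  assumes "\<And>x. B *v x = 0 \<Longrightarrow> x = 0"
  shows "invertible B"
  using assms matrix_left_invertible_ker[of B] invertible_left_inverse[of B] by blast

lemma matrix_inv_cancel:
  fixes B :: "real ^ 'n ^ 'n"
  assumes "invertible B"
  shows "B ** matrix_inv B = mat 1" "matrix_inv B ** B = mat 1"
  using someI_ex[OF assms[unfolded invertible_def]] by (simp_all add: matrix_inv_def)

lemma matrix_inv_mult_vector:
  fixes B :: "real ^ 'n ^ 'n"
  assumes "invertible B"
  shows "B *v (matrix_inv B *v x) = x" "matrix_inv B *v (B *v x) = x"
  using matrix_inv_cancel[OF assms]
  by (simp_all add: matrix_vector_mul_assoc)

lemma inner_transpose_mult_vector: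
  fixes B :: "real ^ 'n ^ 'm"
  shows "x \<bullet> (transpose B *v z) = (B *v x) \<bullet> z"
  by (metis dot_lmul_matrix inner_commute transpose_matrix_vector transpose_transpose)

text \<open>Pairing \<open>transpose B *v (B *v x)\<close> with \<open>x\<close> gives the squared
  norm of \<open>B *v x\<close>, so the Gram matrix has no larger kernel than
  \<open>B\<close>.\<close>

lemma invertible_gram:
  fixes B :: "real ^ 'n ^ 'm"
  assumes "\<And>x. B *v x = 0 \<Longrightarrow> x = 0"
  shows "invertible (transpose B ** B)"
proof (rule invertible_if_kernel_trivial)
  fix x assume "(transpose B ** B) *v x = 0"
  then have "x \<bullet> (transpose B *v (B *v x)) = 0"
    by (simp add: matrix_vector_mul_assoc)
  then show "x = 0"
    using assms by (simp add: inner_transpose_mult_vector)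
qed

section \<open>Normal equations of generalized least squares\<close>

text \<open>Trades the closed formula with its nested inverses for two linear equations. The witness
  is the residual \<open>y - M *v \<theta>\<close> multiplied by the inverse of
  \<open>\<Sigma>\<close>.\<close>

lemma gls_normal_equations:
  fixes M :: "real ^ 'k ^ 'p" and \<Sigma> :: "real ^ 'p ^ 'p"
  assumes pos: "\<And>z. z \<noteq> 0 \<Longrightarrow> z \<bullet> (\<Sigma> *v z) > 0"
    and inj: "\<And>x. M *v x = 0 \<Longrightarrow> x = 0"
  obtains u where "\<Sigma> *v u = y - M *v gls_estimator M \<Sigma> y" "transpose M *v u = 0"
proof -
  define V where "V = matrix_inv \<Sigma>"
  define W where "W = transpose M ** V ** M"
  have "invertible \<Sigma>"
    by (rule invertible_if_kernel_trivial) (metis inner_zero_right less_irrefl pos)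
  then have V: "\<Sigma> *v (V *v x) = x" for x
    by (simp add: V_def matrix_inv_mult_vector)
  have "invertible W"
  proof (rule invertible_if_kernel_trivial)
    fix x assume "W *v x = 0"
    then have "x \<bullet> (transpose M *v (V *v (M *v x))) = 0"
      by (simp add: W_def matrix_vector_mul_assoc[symmetric])
    \<comment> \<open>With \<open>z = V *v (M *v x)\<close> one has
      \<open>M *v x = \<Sigma> *v z\<close>, so positivity is only used for \<open>\<Sigma>\<close>
      and never for its inverse.\<close>
    then have "(V *v (M *v x)) \<bullet> (\<Sigma> *v (V *v (M *v x))) = 0"
      by (simp add: inner_transpose_mult_vector V inner_commute)
    then have "V *v (M *v x) = 0"
      using pos by fastforce
    then have "M *v x = 0"
      using V by (metis matrix_vector_mult_0_right)
    then show "x = 0" by (rule inj)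
  qed
  define \<theta> where "\<theta> = gls_estimator M \<Sigma> y"
  have \<theta>: "\<theta> = matrix_inv W *v (transpose M *v (V *v y))"
    by (simp add: \<theta>_def gls_estimator_def V_def W_def matrix_vector_mul_assoc[symmetric])
  have "W *v \<theta> = transpose M *v (V *v y)"
    unfolding \<theta> using \<open>invertible W\<close> by (rule matrix_inv_mult_vector)
  then have "transpose M *v (V *v (y - M *v \<theta>)) = 0"
    by (simp add: W_def matrix_vector_mult_diff_distrib matrix_vector_mul_assoc[symmetric])
  then show ?thesis
    using that[of "V *v (y - M *v \<theta>)"] V by (simp add: \<theta>_def)
qed

section \<open>Membership matrices and the within-category scatter\<close>

text \<open>Every category \<open>k\<close> owns some profile \<open>i\<close>, and row
  \<open>i\<close> of \<open>A\<close> is then the unit vector at \<open>k\<close>, so entry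
  \<open>i\<close> of \<open>A *v x\<close> reads off \<open>x $ k\<close>.\<close>

lemma source_membership_inj:
  assumes "source_membership A" "A *v x = 0"
  shows "x = 0"
proof -
  have "x $ k = 0" for k
  proof -
    obtain i where i: "A $ i $ k = 1"
      using assms(1) unfolding source_membership_def by blast
    have "A $ i $ j = (if j = k then 1 else 0)" for j
      using assms(1) i unfolding source_membership_def by (metis empty_iff insert_iff)
    then have "(A *v x) $ i = x $ k"
      by (simp add: matrix_vector_mult_def if_distrib[of "\<lambda>t. t * _"] cong: if_cong)
    then show ?thesis using assms(2) by simp
  qed
  then show ?thesis by (simp add: vec_eq_iff)
qed

lemma membership_proj_mult_vector:
  "membership_proj A *v x = A *v (matrix_inv (transpose A ** A) *v (transpose A *v x))"
  by (simp add: membership_proj_def matrix_vector_mul_assoc[symmetric])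

text \<open>The projection of \<open>x\<close> is \<open>A *v v\<close> with \<open>v\<close>
  solving the normal equations, and the gap between the two sides is the squared norm of
  \<open>x - A *v v\<close>.\<close>

lemma membership_proj_inner_le:
  fixes A :: "real ^ 'k ^ 'n"
  assumes "invertible (transpose A ** A)"
  shows "x \<bullet> (membership_proj A *v x) \<le> x \<bullet> x"
proof -
  define v where "v = matrix_inv (transpose A ** A) *v (transpose A *v x)"
  have "(transpose A ** A) *v v = transpose A *v x"
    unfolding v_def using assms by (rule matrix_inv_mult_vector)
  then have "v \<bullet> (transpose A *v (A *v v)) = v \<bullet> (transpose A *v x)"
    by (simp add: matrix_vector_mul_assoc[symmetric])
  then have "(A *v v) \<bullet> (A *v v) = x \<bullet> (A *v v)"
    by (simp add: inner_transpose_mult_vector inner_commute)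
  moreover have "(x - A *v v) \<bullet> (x - A *v v) \<ge> 0"
    by simp
  ultimately show ?thesis
    by (simp add: membership_proj_mult_vector v_def[symmetric] inner_diff inner_commute)
qed

lemma within_scatter_mult_vector:
  "within_scatter X A *v u
     = X *v (transpose X *v u - membership_proj A *v (transpose X *v u))"
  by (simp add: within_scatter_def matrix_vector_mul_assoc[symmetric] matrix_vector_mult_diff_rdistrib)

lemma within_scatter_nonneg:
  fixes X :: "real ^ 'n ^ 'p" and A :: "real ^ 'k ^ 'n"
  assumes "invertible (transpose A ** A)"
  shows "z \<bullet> (within_scatter X A *v z) \<ge> 0"
proof -
  have "z \<bullet> (within_scatter X A *v z)
      = (transpose X *v z) \<bullet> (transpose X *v z - membership_proj A *v (transpose X *v z))"
    unfolding within_scatter_mult_vector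
    using inner_transpose_mult_vector[of z "transpose X"] by simp
  then show ?thesis
    using membership_proj_inner_le[OF assms, of "transpose X *v z"] by (simp add: inner_diff_right)
qed

text \<open>Cauchy-Schwarz with one factor \<open>norm x\<close> cancelled; needed below with
  \<open>c = 1\<close> and with \<open>c = \<gamma>\<close>.\<close>

lemma norm_le_if_inner_self_le:
  fixes x y :: "'a :: real_inner"
  assumes "c * (x \<bullet> x) \<le> x \<bullet> y"
  shows "c * norm x \<le> norm y"
proof (cases "x = 0")
  case False
  have "norm x * (c * norm x) \<le> norm x * norm y"
    using assms norm_cauchy_schwarz[of x y]
    by (simp add: power2_norm_eq_inner[symmetric] power2_eq_square mult_ac)
  then show ?thesis using False by simp
qed simp

section \<open>Residual of the regularized estimator and its two error formulas\<close>

text \<open>The vector obtained here is \<open>c\<close> times the one from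
  \<open>gls_normal_equations\<close>; this absorbs the arbitrary scale of \<open>\<Sigma>\<close>,
  and \<open>c\<close> is absent from both equations.\<close>

lemma regularized_gls_residual:
  fixes X :: "real ^ 'n ^ 'p" and A :: "real ^ 'k ^ 'n" and y :: "real ^ 'p"
  assumes injX: "\<And>x. X *v x = 0 \<Longrightarrow> x = 0"
    and injA: "\<And>x. A *v x = 0 \<Longrightarrow> x = 0"
    and "\<gamma> > 0" "c > 0"
    and \<Sigma>: "\<Sigma> = c *\<^sub>R (within_scatter X A + \<gamma> *\<^sub>R mat 1)"
  defines "N \<equiv> transpose A ** A"
    and "\<theta> \<equiv> gls_estimator (category_means X A) \<Sigma> y"
  obtains u where
    "X *v (transpose X *v u) + \<gamma> *\<^sub>R u + X *v (A *v (matrix_inv N *v \<theta>)) = y"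
    "transpose A *v (transpose X *v u) = 0"
proof -
  define M where "M = category_means X A"
  have invN: "invertible N"
    unfolding N_def by (rule invertible_gram) (rule injA)
  have Mv: "M *v x = X *v (A *v (matrix_inv N *v x))" for x
    by (simp add: M_def category_means_def N_def matrix_vector_mul_assoc[symmetric])
  have \<Sigma>v: "\<Sigma> *v z = c *\<^sub>R (within_scatter X A *v z + \<gamma> *\<^sub>R z)" for z
    by (simp add: \<Sigma> matrix_vector_mult_add_rdistrib scaleR_matrix_vector_assoc[symmetric])
  have "z \<bullet> (\<Sigma> *v z) > 0" if "z \<noteq> 0" for z
    using within_scatter_nonneg[OF invN[unfolded N_def], of z X] that \<open>\<gamma> > 0\<close> \<open>c > 0\<close>
    by (simp add: \<Sigma>v inner_add_right add_nonneg_pos)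
  moreover have "x = 0" if "M *v x = 0" for x
    using that injA injX matrix_inv_mult_vector(1)[OF invN, of x]
    by (metis Mv matrix_vector_mult_0_right)
  ultimately obtain u where u: "\<Sigma> *v u = y - M *v \<theta>" "transpose M *v u = 0"
    unfolding \<theta>_def M_def[symmetric] by (metis gls_normal_equations)
  have Aw: "transpose A *v (transpose X *v (c *\<^sub>R u)) = 0"
  proof -
    have "X ** A = M ** N"
      using matrix_inv_cancel[OF invN]
      by (simp add: M_def category_means_def N_def[symmetric] matrix_mul_assoc[symmetric])
    then have "transpose (X ** A) *v u = transpose (M ** N) *v u" by simp
    then have "transpose A *v (transpose X *v u) = transpose N *v (transpose M *v u)"
      by (simp add: matrix_transpose_mul matrix_vector_mul_assoc[symmetric])
    then show ?thesis using u(2) by (simp add: matrix_vector_mult_scaleR)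
  qed
  \<comment> \<open>The projection starts by applying \<open>transpose A\<close>, which annihilates
    \<open>transpose X *v (c *\<^sub>R u)\<close>.\<close>
  then have "within_scatter X A *v (c *\<^sub>R u) = X *v (transpose X *v (c *\<^sub>R u))"
    by (simp add: within_scatter_mult_vector membership_proj_mult_vector)
  moreover have "\<Sigma> *v u = within_scatter X A *v (c *\<^sub>R u) + \<gamma> *\<^sub>R (c *\<^sub>R u)"
    by (simp add: \<Sigma>v matrix_vector_mult_scaleR scaleR_add_right mult.commute)
  ultimately have "X *v (transpose X *v (c *\<^sub>R u)) + \<gamma> *\<^sub>R (c *\<^sub>R u) = \<Sigma> *v u"
    by simp
  then show ?thesis
    using that[OF _ Aw] u(1) by (simp add: Mv)
qed

text \<open>One \<open>w\<close> serves both error formulas. Neither the bounds nor the matrices in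
  front of \<open>w\<close> involve \<open>\<gamma>\<close> or \<open>c\<close>, which is what lets
  both limits be read off.\<close>

lemma regularized_gls_representation:
  fixes X :: "real ^ 'n ^ 'p" and A :: "real ^ 'k ^ 'n" and y :: "real ^ 'p"
  assumes injX: "\<And>x. X *v x = 0 \<Longrightarrow> x = 0"
    and injA: "\<And>x. A *v x = 0 \<Longrightarrow> x = 0"
    and "\<gamma> > 0" "c > 0"
    and \<Sigma>: "\<Sigma> = c *\<^sub>R (within_scatter X A + \<gamma> *\<^sub>R mat 1)"
  defines "G \<equiv> transpose X ** X"
    and "\<theta> \<equiv> gls_estimator (category_means X A) \<Sigma> y"
  obtains w where
    "norm w \<le> norm (matrix_inv G *v (transpose X *v y))"
    "\<gamma> * norm w \<le> onorm ((*v) (transpose X)) * norm y"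
    "\<theta> = theta_RTS X A y - (transpose A ** matrix_inv G) *v (\<gamma> *\<^sub>R w)"
    "\<theta> = theta_ATR X A y - (transpose A ** A ** matrix_inv (transpose A ** G ** A) ** transpose A ** G) *v w"
proof -
  define N where "N = transpose A ** A"
  define R where "R = transpose A ** G ** A"
  define b where "b = matrix_inv G *v (transpose X *v y)"
  define t where "t = matrix_inv N *v \<theta>"
  obtain u where y: "X *v (transpose X *v u) + \<gamma> *\<^sub>R u + X *v (A *v t) = y"
    and Aw0: "transpose A *v (transpose X *v u) = 0"
    unfolding t_def N_def \<theta>_def
    by (rule regularized_gls_residual[OF injX injA \<open>\<gamma> > 0\<close> \<open>c > 0\<close> \<Sigma>]) blast
  define w where "w = transpose X *v u"
  note Aw = Aw0[folded w_def]
  have invG: "invertible G"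
    unfolding G_def by (rule invertible_gram) (rule injX)
  have invN: "invertible N"
    unfolding N_def by (rule invertible_gram) (rule injA)
  have invR: "invertible R"
  proof -
    have "invertible (transpose (X ** A) ** (X ** A))"
      by (rule invertible_gram)
        (use injX injA in \<open>simp add: matrix_vector_mul_assoc[symmetric]\<close>)
    then show ?thesis by (simp add: R_def G_def matrix_transpose_mul matrix_mul_assoc[symmetric])
  qed
  have \<theta>: "\<theta> = N *v t"
    unfolding t_def using invN by (rule matrix_inv_mult_vector(1)[symmetric])
  have XX: "transpose X *v (X *v x) = G *v x" for x
    by (simp add: G_def matrix_vector_mul_assoc[symmetric])
  have wA: "w \<bullet> (A *v x) = 0" for x
    using inner_transpose_mult_vector[of x A w] Aw by (simp add: inner_commute)
  have "transpose X *v (X *v (transpose X *v u) + \<gamma> *\<^sub>R u + X *v (A *v t)) = transpose X *v y"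
    using y by simp
  then have Xy: "G *v w + \<gamma> *\<^sub>R w + G *v (A *v t) = transpose X *v y"
    by (simp add: matrix_vector_right_distrib matrix_vector_mult_scaleR w_def XX)
  then have "matrix_inv G *v (G *v w + \<gamma> *\<^sub>R w + G *v (A *v t)) = b"
    by (simp add: b_def)
  then have b: "w + \<gamma> *\<^sub>R (matrix_inv G *v w) + A *v t = b"
    by (simp add: matrix_vector_right_distrib matrix_vector_mult_scaleR matrix_inv_mult_vector[OF invG])
  \<comment> \<open>Substituting \<open>w = G *v v\<close> turns this into the squared norm of
    \<open>X *v v\<close>.\<close>
  have "w \<bullet> (matrix_inv G *v w) \<ge> 0"
  proof -
    define v where "v = matrix_inv G *v w"
    have "w = G *v v"
      unfolding v_def using invG by (rule matrix_inv_mult_vector(1)[symmetric])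
    then have "w \<bullet> v = v \<bullet> (transpose X *v (X *v v))"
      by (simp add: XX inner_commute)
    then show ?thesis by (simp add: v_def[symmetric] inner_transpose_mult_vector)
  qed
  then have "1 * (w \<bullet> w) \<le> w \<bullet> b"
    unfolding b[symmetric] using \<open>\<gamma> > 0\<close> by (simp add: inner_add_right wA)
  then have 1: "norm w \<le> norm b"
    using norm_le_if_inner_self_le[of 1 w b] by simp
  have uX: "u \<bullet> (X *v x) = w \<bullet> x" for x
    using inner_transpose_mult_vector[of x X u] by (simp add: w_def inner_commute)
  \<comment> \<open>Expanding \<open>u \<bullet> y\<close> gives \<open>w \<bullet> w\<close> plus
    the left side; the fitted term vanishes because \<open>w\<close> is orthogonal to the range of
    \<open>A\<close>.\<close>
  have "\<gamma> * (u \<bullet> u) \<le> u \<bullet> y"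
    unfolding y[symmetric] by (simp add: inner_add_right uX wA w_def[symmetric])
  then have u_le: "\<gamma> * norm u \<le> norm y"
    by (rule norm_le_if_inner_self_le)
  have bl: "bounded_linear ((*v) (transpose X))"
    by (rule matrix_vector_mul_bounded_linear)
  have "\<gamma> * norm w \<le> \<gamma> * (onorm ((*v) (transpose X)) * norm u)"
    unfolding w_def using onorm[OF bl, of u] \<open>\<gamma> > 0\<close> by simp
  also have "\<dots> = onorm ((*v) (transpose X)) * (\<gamma> * norm u)"
    by simp
  also have "\<dots> \<le> onorm ((*v) (transpose X)) * norm y"
    using u_le onorm_pos_le[OF bl] by (rule mult_left_mono)
  finally have 2: "\<gamma> * norm w \<le> onorm ((*v) (transpose X)) * norm y" .
  \<comment> \<open>Here \<open>transpose A\<close> removes the bare \<open>w\<close> and turns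
    \<open>A *v t\<close> into \<open>\<theta>\<close>, leaving an error proportional to
    \<open>\<gamma>\<close>.\<close>
  have "transpose A *v (w + \<gamma> *\<^sub>R (matrix_inv G *v w) + A *v t) = transpose A *v b"
    using b by simp
  then have "\<theta> = transpose A *v b - transpose A *v (\<gamma> *\<^sub>R (matrix_inv G *v w))"
    by (simp add: matrix_vector_right_distrib Aw \<theta> N_def matrix_vector_mul_assoc[symmetric] algebra_simps)
  then have 3: "\<theta> = theta_RTS X A y - (transpose A ** matrix_inv G) *v (\<gamma> *\<^sub>R w)"
    by (simp add: theta_RTS_def b_def G_def matrix_vector_mul_assoc[symmetric] matrix_vector_mult_scaleR)
  \<comment> \<open>Before \<open>G\<close> is inverted, the bare term is
    \<open>\<gamma> *\<^sub>R w\<close>; now that one drops out, and the error that survives has no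
    factor \<open>\<gamma>\<close>.\<close>
  have "transpose A *v (G *v w + \<gamma> *\<^sub>R w + G *v (A *v t)) = transpose A *v (transpose X *v y)"
    using Xy by simp
  then have "R *v t = transpose A *v (transpose X *v y) - transpose A *v (G *v w)"
    by (simp add: matrix_vector_right_distrib matrix_vector_mult_scaleR Aw R_def
        matrix_vector_mul_assoc[symmetric] algebra_simps)
  then have "matrix_inv R *v (R *v t)
      = matrix_inv R *v (transpose A *v (transpose X *v y) - transpose A *v (G *v w))"
    by simp
  then have "\<theta> = N *v (matrix_inv R *v (transpose A *v (transpose X *v y) - transpose A *v (G *v w)))"
    by (simp add: \<theta> matrix_inv_mult_vector[OF invR])
  moreover have "theta_ATR X A y = N *v (matrix_inv R *v (transpose A *v (transpose X *v y)))"
    by (simp add: theta_ATR_def N_def R_def G_def matrix_mul_assoc matrix_vector_mul_assoc[symmetric])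
  ultimately have 4: "\<theta> = theta_ATR X A y - (N ** matrix_inv R ** transpose A ** G) *v w"
    by (simp add: matrix_vector_mult_diff_distrib matrix_vector_mul_assoc[symmetric])
  show ?thesis
    using that[of w] 1 2 3 4 by (simp add: b_def N_def R_def)
qed

section \<open>Passage to the two limits\<close>

text \<open>The vector \<open>v\<close> is existential at each point, so the vectors
  \<open>w\<close> need not be assembled into a function of \<open>\<gamma>\<close>.\<close>

lemma tendsto_diff_linear_image:
  fixes f :: "'a \<Rightarrow> real ^ 'm" and B :: "real ^ 'n ^ 'm"
  assumes f: "\<forall>\<^sub>F x in F. \<exists>v. norm v \<le> g x \<and> f x = l - B *v v"
    and g: "(g \<longlongrightarrow> 0) F"
  shows "(f \<longlongrightarrow> l) F"
proof -
  have bl: "bounded_linear ((*v) B)"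
    by (rule matrix_vector_mul_bounded_linear)
  have "\<forall>\<^sub>F x in F. norm (f x - l) \<le> onorm ((*v) B) * g x"
    using f
  proof eventually_elim
    case (elim x)
    then obtain v where v: "norm v \<le> g x" "f x = l - B *v v" by blast
    have "norm (f x - l) \<le> onorm ((*v) B) * norm v"
      using onorm[OF bl, of v] v(2) by simp
    also have "\<dots> \<le> onorm ((*v) B) * g x"
      using v(1) onorm_pos_le[OF bl] by (rule mult_left_mono)
    finally show ?case .
  qed
  moreover have "((\<lambda>x. onorm ((*v) B) * g x) \<longlongrightarrow> 0) F"
    using tendsto_mult_right_zero[OF g] .
  ultimately have "((\<lambda>x. f x - l) \<longlongrightarrow> 0) F"
    by (rule Lim_null_comparison)
  then show ?thesis by (rule LIM_zero_cancel)
qed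

theorem proposition2:
  fixes X :: "real ^ 'n ^ 'p" and A :: "real ^ 'k ^ 'n" and y :: "real ^ 'p"
    and \<Sigma> :: "real \<Rightarrow> real ^ 'p ^ 'p"
  assumes "CARD('n) < CARD('p)"
    and "rank X = CARD('n)"
    and "source_membership A"
    and "\<And>\<gamma>. \<gamma> > 0 \<Longrightarrow> \<exists>c>0. \<Sigma> \<gamma> = c *\<^sub>R (within_scatter X A + \<gamma> *\<^sub>R mat 1)"
  shows "((\<lambda>\<gamma>. gls_estimator (category_means X A) (\<Sigma> \<gamma>) y) \<longlongrightarrow> theta_RTS X A y) (at_right 0)
       \<and> ((\<lambda>\<gamma>. gls_estimator (category_means X A) (\<Sigma> \<gamma>) y) \<longlongrightarrow> theta_ATR X A y) at_top"
proof -
  define G where "G = transpose X ** X"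
  define \<theta> where "\<theta> \<gamma> = gls_estimator (category_means X A) (\<Sigma> \<gamma>) y" for \<gamma>
  define \<beta> where "\<beta> = norm (matrix_inv G *v (transpose X *v y))"
  define \<kappa> where "\<kappa> = onorm ((*v) (transpose X)) * norm y"
  define B where "B = transpose A ** matrix_inv G"
  define D where "D = transpose A ** A ** matrix_inv (transpose A ** G ** A) ** transpose A ** G"
  have injX: "x = 0" if "X *v x = 0" for x
    using that full_rank_injective[of X] assms(2) by (metis injD matrix_vector_mult_0_right)
  have injA: "x = 0" if "A *v x = 0" for x
    using source_membership_inj assms(3) that by blast
  have rep: "\<exists>w. norm w \<le> \<beta> \<and> \<gamma> * norm w \<le> \<kappa> \<and> \<theta> \<gamma> = theta_RTS X A y - B *v (\<gamma> *\<^sub>R w)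
      \<and> \<theta> \<gamma> = theta_ATR X A y - D *v w" if "\<gamma> > 0" for \<gamma>
  proof -
    obtain c where "c > 0" "\<Sigma> \<gamma> = c *\<^sub>R (within_scatter X A + \<gamma> *\<^sub>R mat 1)"
      using assms(4) \<open>\<gamma> > 0\<close> by blast
    from regularized_gls_representation[OF injX injA \<open>\<gamma> > 0\<close> this, where y = y]
    show ?thesis
      unfolding \<theta>_def \<beta>_def \<kappa>_def B_def D_def G_def by metis
  qed
  \<comment> \<open>Near zero take \<open>v = \<gamma> *\<^sub>R w\<close>, where the uniform bound
    \<open>\<beta>\<close> on \<open>w\<close> suffices.\<close>
  have "(\<theta> \<longlongrightarrow> theta_RTS X A y) (at_right 0)"
  proof (rule tendsto_diff_linear_image)
    show "\<forall>\<^sub>F \<gamma> in at_right 0. \<exists>v. norm v \<le> \<gamma> * \<beta> \<and> \<theta> \<gamma> = theta_RTS X A y - B *v v"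
      using eventually_at_right_less[of "0::real"]
    proof eventually_elim
      case (elim \<gamma>)
      then obtain w where "norm w \<le> \<beta>" "\<theta> \<gamma> = theta_RTS X A y - B *v (\<gamma> *\<^sub>R w)"
        using rep by blast
      then show ?case
        using elim by (intro exI[of _ "\<gamma> *\<^sub>R w"]) simp
    qed
    have "((\<lambda>\<gamma>::real. \<gamma> * \<beta>) \<longlongrightarrow> 0 * \<beta>) (at_right 0)"
      by (intro tendsto_intros)
    then show "((\<lambda>\<gamma>::real. \<gamma> * \<beta>) \<longlongrightarrow> 0) (at_right 0)"
      by simp
  qed
  \<comment> \<open>For large \<open>\<gamma>\<close> take \<open>v = w\<close>; the bound
    \<open>\<kappa>\<close> on \<open>\<gamma> * norm w\<close> forces decay like
    \<open>1 / \<gamma>\<close>.\<close>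
  moreover have "(\<theta> \<longlongrightarrow> theta_ATR X A y) at_top"
  proof (rule tendsto_diff_linear_image)
    show "\<forall>\<^sub>F \<gamma> in at_top. \<exists>v. norm v \<le> \<kappa> / \<gamma> \<and> \<theta> \<gamma> = theta_ATR X A y - D *v v"
      using eventually_gt_at_top[of "0::real"]
    proof eventually_elim
      case (elim \<gamma>)
      then obtain w where "\<gamma> * norm w \<le> \<kappa>" "\<theta> \<gamma> = theta_ATR X A y - D *v w"
        using rep by blast
      then show ?case
        using elim by (intro exI[of _ w]) (simp add: field_simps)
    qed
    show "((\<lambda>\<gamma>. \<kappa> / \<gamma>) \<longlongrightarrow> 0) at_top"
      by (rule tendsto_divide_0[OF tendsto_const filterlim_at_top_imp_at_infinity[OF filterlim_ident]])
  qed
  ultimately show ?thesis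
    unfolding \<theta>_def by blast
qed

end
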